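(* Let $n\ge 2$, $k\ge 1$ and let $l\neq 0$ be an integer. Then $$A_l(n)\log n = l\sum_{\substack{d\ge 2,\ i\ge 1\\ d^i\mid n}} A_l(n/d^i)\log d,$$ $$B_l(n)\log n = l\sum_{\substack{d\ge 2,\ i\ge 1\\ d^i\mid n}} (-1)^{i+1}B_l(n/d^i)\log d,$$ $$f_{k,l}(n)\log n = l\sum_{\substack{d\ge 2,\ 1\le i\le k\\ d^i\mid n}} f_{k-i,l}(n/d^i)\log d,$$ $$g_{k,l}(n)\log n = l\sum_{\substack{d\ge 2,\ 1\le i\le k\\ d^i\mid n}} (-1)^{i+1}g_{k-i,l}(n/d^i)\log d,$$ where the sums run over all pairs of integers $(d,i)$ satisfying the indicated conditions, with boundary conditions $A_l(1)=B_l(1)=1$, and $f_{k,l}(1)=g_{k,l}(1)=1$ if $k=0$ and $f_{k,l}(1)=g_{k,l}(1)=0$ if $k\ge 1$.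
   Context: For an integer $l\ge 1$, an $l$-colored part is a pair $(d,c)$ with $d\ge 2$ an integer (its value) and $c\in\{1,\dots,l\}$ (its color). An unordered $l$-colored factorization of an integer $n\ge 2$ is a finite multiset of $l$-colored parts whose values (with multiplicity) have product $n$ (the one-part factorizations $(n,c)$ are included). It is called distinct if no pair $(d,c)$ occurs more than once. For $l\ge 1$ and $n\ge 2$: $A_l(n)$ is the number of unordered $l$-colored factorizations of $n$; $B_l(n)$ is the number of distinct unordered $l$-colored factorizations of $n$; for $k\ge 1$, $f_{k,l}(n)$ (respectively $g_{k,l}(n)$) is the number of unordered (respectively distinct unordered) $l$-colored factorizations of $n$ with exactly $k$ parts. Also $f_{0,l}(n)=g_{0,l}(n)=0$ for $n\ge 2$. For negative integers $l$, the functions are defined as the coefficients in the (formal) Dirichlet series expansions $$1+\sum_{n\ge 2}A_l(n)n^{-s}=\prod_{n\ge 2}(1-n^{-s})^{-l},\qquad 1+\sum_{n\ge 2}B_l(n)n^{-s}=\prod_{n\ge 2}(1+n^{-s})^{l},$$ $$1+\sum_{n\ge 2}\sum_{k\ge 1}f_{k,l}(n)n^{-s}z^k=\prod_{n\ge 2}(1-zn^{-s})^{-l},\qquad 1+\sum_{n\ge 2}\sum_{k\ge 1}g_{k,l}(n)n^{-s}z^k=\prod_{n\ge 2}(1+zn^{-s})^{l},$$ together with the same conventions at $n=1$ and for $k=0$ (these expansions also hold for $l\ge 1$). *)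

theory Defs
  imports Complex_Main "HOL-Library.Multiset" "HOL-Computational_Algebra.Formal_Power_Series"
begin

section \<open>Formal Dirichlet series\<close>

text \<open>
  A formal Dirichlet series is the sequence of its coefficients at n = 1, 2, 3, ...;
  the entry at index 0 is pinned to zero so that equality of series is equality of sequences.
\<close>

typedef (overloaded) 'a fds = "{f :: nat \<Rightarrow> 'a::zero. f 0 = 0}"
  morphisms fds_nth Abs_fds
  by (rule exI[of _ "\<lambda>_. 0"]) simp

definition fds :: "(nat \<Rightarrow> 'a::zero) \<Rightarrow> 'a fds" where
  "fds f = Abs_fds (\<lambda>n. if n = 0 then 0 else f n)"

lemma fds_nth_fds: "fds_nth (fds f) n = (if n = 0 then 0 else f n)"
  by (simp add: fds_def Abs_fds_inverse)

lemma fds_nth_0 [simp]: "fds_nth f 0 = 0"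
  using fds_nth[of f] by simp

lemma fds_eqI: "(\<And>n. n > 0 \<Longrightarrow> fds_nth f n = fds_nth g n) \<Longrightarrow> f = g"
  by (metis fds_nth_0 fds_nth_inject ext gr0I)

instantiation fds :: (comm_ring_1) comm_ring_1
begin

definition zero_fds :: "'a fds" where "0 = fds (\<lambda>_. 0)"
definition one_fds :: "'a fds" where "1 = fds (\<lambda>n. if n = 1 then 1 else 0)"
definition plus_fds :: "'a fds \<Rightarrow> 'a fds \<Rightarrow> 'a fds" where
  "f + g = fds (\<lambda>n. fds_nth f n + fds_nth g n)"
definition uminus_fds :: "'a fds \<Rightarrow> 'a fds" where "- f = fds (\<lambda>n. - fds_nth f n)"
definition minus_fds :: "'a fds \<Rightarrow> 'a fds \<Rightarrow> 'a fds" where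
  "f - g = fds (\<lambda>n. fds_nth f n - fds_nth g n)"
definition times_fds :: "'a fds \<Rightarrow> 'a fds \<Rightarrow> 'a fds" where
  "f * g = fds (\<lambda>n. \<Sum>(a, b) | a * b = n. fds_nth f a * fds_nth g b)"

lemma fds_nth_ring_ops:
  "fds_nth (0 :: 'a fds) n = 0"
  "fds_nth (1 :: 'a fds) n = (if n = 1 then 1 else 0)"
  "fds_nth (f + g :: 'a fds) n = fds_nth f n + fds_nth g n"
  "fds_nth (- f :: 'a fds) n = - fds_nth f n"
  "fds_nth (f - g :: 'a fds) n = fds_nth f n - fds_nth g n"
  by (simp_all add: zero_fds_def one_fds_def plus_fds_def uminus_fds_def minus_fds_def fds_nth_fds)

lemma fds_nth_mult:
  "n > 0 \<Longrightarrow> fds_nth (f * g :: 'a fds) n = (\<Sum>(a, b) | a * b = n. fds_nth f a * fds_nth g b)"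
  by (simp add: times_fds_def fds_nth_fds)

lemma finite_mult_pairs: "n > 0 \<Longrightarrow> finite {(a, b). a * b = (n::nat)}"
  by (rule finite_subset[of _ "{..n} \<times> {..n}"]) auto

lemma fds_mult_commute: "f * g = g * (f :: 'a fds)"
proof (rule fds_eqI)
  fix n :: nat assume "n > 0"
  then show "fds_nth (f * g) n = fds_nth (g * f) n"
    by (simp add: fds_nth_mult,
        intro sum.reindex_bij_witness[of _ "\<lambda>(a, b). (b, a)" "\<lambda>(a, b). (b, a)"])
       (auto simp: mult.commute)
qed

lemma fds_mult_assoc: "f * g * h = f * (g * (h :: 'a fds))"
proof (rule fds_eqI)
  fix n :: nat assume n: "n > 0"
  have fin: "finite {(a, b). a * b = m}" if "m dvd n" for m
    using n that by (intro finite_mult_pairs) (auto intro: gr0I)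
  have "fds_nth (f * g * h) n =
      (\<Sum>p | fst p * snd p = n. \<Sum>q | fst q * snd q = fst p.
         fds_nth f (fst q) * fds_nth g (snd q) * fds_nth h (snd p))"
    using n by (auto simp: fds_nth_mult case_prod_unfold sum_distrib_right intro!: sum.cong)
  also have "\<dots> = (\<Sum>(p, q) \<in> (SIGMA p : {p. fst p * snd p = n}. {q. fst q * snd q = fst p}).
         fds_nth f (fst q) * fds_nth g (snd q) * fds_nth h (snd p))"
    using fin finite_mult_pairs[OF n] by (intro sum.Sigma) (auto simp: case_prod_unfold)
  also have "\<dots> = (\<Sum>(p, q) \<in> (SIGMA p : {p. fst p * snd p = n}. {q. fst q * snd q = snd p}).
         fds_nth f (fst p) * fds_nth g (fst q) * fds_nth h (snd q))"
    by (intro sum.reindex_bij_witness[of _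
          "\<lambda>((a, m), (b, c)). ((a * b, c), (a, b))" "\<lambda>((m, c), (a, b)). ((a, b * c), (b, c))"])
       (auto simp: mult.assoc)
  also have "\<dots> = (\<Sum>p | fst p * snd p = n. \<Sum>q | fst q * snd q = snd p.
         fds_nth f (fst p) * fds_nth g (fst q) * fds_nth h (snd q))"
    using fin finite_mult_pairs[OF n] by (intro sum.Sigma[symmetric]) (auto simp: case_prod_unfold)
  also have "\<dots> = fds_nth (f * (g * h)) n"
    using n by (auto simp: fds_nth_mult case_prod_unfold sum_distrib_left mult.assoc intro!: sum.cong)
  finally show "fds_nth (f * g * h) n = fds_nth (f * (g * h)) n" .
qed

lemma fds_mult_1: "1 * f = (f :: 'a fds)"
proof (rule fds_eqI)
  fix n :: nat assume n: "n > 0"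
  have "fds_nth (1 * f) n = (\<Sum>p \<in> {(1, n)}. fds_nth 1 (fst p) * fds_nth f (snd p))"
    using n finite_mult_pairs[OF n]
    by (simp only: fds_nth_mult case_prod_unfold, intro sum.mono_neutral_right)
       (auto simp: fds_nth_ring_ops case_prod_unfold)
  then show "fds_nth (1 * f) n = fds_nth f n" by (simp add: fds_nth_ring_ops)
qed

instance
proof
  fix f g h :: "'a fds"
  show "(f + g) * h = f * h + g * h"
    by (rule fds_eqI)
       (simp add: fds_nth_mult fds_nth_ring_ops sum.distrib case_prod_unfold distrib_right)
  have "fds_nth (0 :: 'a fds) 1 \<noteq> fds_nth 1 1" by (simp add: fds_nth_ring_ops)
  then show "(0 :: 'a fds) \<noteq> 1" by metis
qed (auto intro!: fds_eqI fds_mult_commute fds_mult_assoc fds_mult_1 simp: fds_nth_ring_ops fds_mult_1)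

end

text \<open>Division is multiplication by the (unique) convolution inverse, and 0 if there is none.\<close>

instantiation fds :: (comm_ring_1) inverse
begin

definition inverse_fds :: "'a fds \<Rightarrow> 'a fds" where
  "inverse_fds f = (if f dvd 1 then THE g. f * g = 1 else 0)"
definition divide_fds :: "'a fds \<Rightarrow> 'a fds \<Rightarrow> 'a fds" where
  "divide_fds f g = f * inverse g"

instance ..

end

lemma fds_mult_inverse:
  assumes "f dvd (1 :: 'a::comm_ring_1 fds)"
  shows "f * inverse f = 1"
proof -
  obtain g where g: "f * g = 1" using assms by (metis dvdE)
  have "(THE g. f * g = 1) = g"
  proof (rule the_equality)
    fix g' assume g': "f * g' = 1"
    have "g' = g' * (f * g)" by (simp only: g mult_1_right)
    also have "\<dots> = (f * g') * g" by (simp only: mult_ac)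
    finally show "g' = g" by (simp only: g' mult_1_left)
  qed (fact g)
  then show ?thesis using assms g by (simp add: inverse_fds_def)
qed

fun fds_inv_coeff :: "(nat \<Rightarrow> 'a::comm_ring_1) \<Rightarrow> nat \<Rightarrow> 'a" where
  "fds_inv_coeff f n = (if n = 0 then 0 else if n = 1 then 1 else
     - (\<Sum>b \<in> {b. b dvd n \<and> b < n}. f (n div b) * fds_inv_coeff f b))"

declare fds_inv_coeff.simps [simp del]

lemma fds_unit:
  fixes f :: "'a::comm_ring_1 fds"
  assumes f1: "fds_nth f 1 = 1"
  shows "f dvd 1"
proof -
  define g where "g = fds (fds_inv_coeff (fds_nth f))"
  have "1 = f * g"
  proof (rule fds_eqI)
    fix n :: nat assume n: "n > 0"
    have "fds_nth (f * g) n = (\<Sum>b | b dvd n. fds_nth f (n div b) * fds_nth g b)"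
      unfolding fds_nth_mult[OF n]
      by (rule sum.reindex_bij_witness[of _ "\<lambda>b. (n div b, b)" snd]) (use n in auto)
    also have "{b. b dvd n} = insert n {b. b dvd n \<and> b < n}"
      using n by (auto dest: dvd_imp_le)
    also have "(\<Sum>b\<in>\<dots>. fds_nth f (n div b) * fds_nth g b) = fds_nth g n +
        (\<Sum>b | b dvd n \<and> b < n. fds_nth f (n div b) * fds_nth g b)"
      using n f1 by (subst sum.insert) auto
    also have "\<dots> = fds_nth 1 n"
    proof (cases "n = 1")
      case True
      then have e: "{b. b dvd n \<and> b < n} = {}" by auto
      show ?thesis unfolding e using True
        by (simp add: g_def fds_nth_fds fds_nth_ring_ops fds_inv_coeff.simps)
    next
      case False
      have "(\<Sum>b | b dvd n \<and> b < n. fds_nth f (n div b) * fds_nth g b) =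
            (\<Sum>b | b dvd n \<and> b < n. fds_nth f (n div b) * fds_inv_coeff (fds_nth f) b)"
        by (intro sum.cong) (auto simp: g_def fds_nth_fds fds_inv_coeff.simps)
      moreover have "fds_nth g n = - (\<Sum>b | b dvd n \<and> b < n. fds_nth f (n div b) * fds_inv_coeff (fds_nth f) b)"
        using n False by (simp add: g_def fds_nth_fds fds_inv_coeff.simps[of _ n])
      ultimately show ?thesis using False by (simp add: fds_nth_ring_ops)
    qed
    finally show "fds_nth 1 n = fds_nth (f * g) n" by simp
  qed
  then show ?thesis by (rule dvdI)
qed

definition fds_monom :: "'a::zero \<Rightarrow> nat \<Rightarrow> 'a fds" where
  "fds_monom c n = fds (\<lambda>m. if m = n then c else 0)"

text \<open>
  The infinite product over n = 2, 3, ...: the coefficient at N is the value at which the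
  coefficients at N of the partial products become stationary.  This happens for every product
  of series whose n-th factor is 1 up to terms of index at least n, in particular for the
  products used below, see \<open>fds_prod_ge2_stationary\<close> and \<open>fds_binomial_powi_one_below\<close>.
\<close>

definition fds_prod_ge2 :: "(nat \<Rightarrow> 'a::comm_ring_1 fds) \<Rightarrow> 'a fds" where
  "fds_prod_ge2 F = fds (\<lambda>N. THE c. \<forall>\<^sub>F M in sequentially. fds_nth (\<Prod>n=2..M. F n) N = c)"

lemma fds_nth_mult_one_below:
  fixes f g :: "'a::comm_ring_1 fds"
  assumes g: "\<And>m. m < K \<Longrightarrow> fds_nth g m = fds_nth 1 m" and N: "N < K"
  shows "fds_nth (f * g) N = fds_nth f N"
proof (cases "N = 0")
  case False
  then have n: "N > 0" by simp
  have "fds_nth (f * g) N = fds_nth (f * 1) N"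
    unfolding fds_nth_mult[OF n]
  proof (intro sum.cong refl)
    fix p assume "p \<in> {(a, b). a * b = N}"
    then have "snd p dvd N" by auto
    then have "snd p < K" using n N by (meson dvd_imp_le le_less_trans)
    then show "(case p of (a, b) \<Rightarrow> fds_nth f a * fds_nth g b) =
               (case p of (a, b) \<Rightarrow> fds_nth f a * fds_nth 1 b)"
      by (simp add: g case_prod_unfold)
  qed
  then show ?thesis by simp
qed simp

lemma fds_powi_one_below:
  fixes g :: "'a::comm_ring_1 fds"
  assumes K: "K \<ge> 2" and g: "\<And>m. m < K \<Longrightarrow> fds_nth g m = fds_nth 1 m" and N: "N < K"
  shows "fds_nth (g powi e) N = fds_nth 1 N"
proof -
  have pow: "fds_nth (h ^ i) m = fds_nth 1 m"
    if "\<And>m. m < K \<Longrightarrow> fds_nth h m = fds_nth 1 m" "m < K" for h :: "'a fds" and i m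
  proof (induction i)
    case (Suc i)
    have "fds_nth (h ^ i * h) m = fds_nth (h ^ i) m"
      by (rule fds_nth_mult_one_below) (use that in auto)
    then show ?case by (simp only: power_Suc2 Suc.IH)
  qed simp
  have "g dvd 1" using g[of 1] K by (intro fds_unit) (simp add: fds_nth_ring_ops)
  then have inv: "inverse g * g = 1" by (simp add: fds_mult_inverse mult.commute)
  have "fds_nth (inverse g) m = fds_nth 1 m" if "m < K" for m
    using fds_nth_mult_one_below[OF g that, of "inverse g"] inv by simp
  then show ?thesis
    using pow[OF g N, of "nat e"] pow[OF _ N, of "inverse g" "nat (- e)"]
    by (cases "e \<ge> 0") (simp_all only: power_int_def if_True if_False)
qed

lemma fds_binomial_powi_one_below:
  assumes "n \<ge> 2" and "m < n"
  shows "fds_nth ((1 + fds_monom c n) powi e) m = fds_nth 1 m"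
    and "fds_nth ((1 - fds_monom c n) powi e) m = fds_nth 1 m"
  by (rule fds_powi_one_below[OF assms(1) _ assms(2)];
      simp add: fds_monom_def fds_nth_fds fds_nth_ring_ops)+

lemma fds_prod_ge2_stationary:
  fixes F :: "nat \<Rightarrow> 'a::comm_ring_1 fds"
  assumes F: "\<And>n m. n \<ge> 2 \<Longrightarrow> m < n \<Longrightarrow> fds_nth (F n) m = fds_nth 1 m" and "N \<le> M"
  shows "fds_nth (fds_prod_ge2 F) N = fds_nth (\<Prod>n=2..M. F n) N"
proof (cases "N = 0")
  case False
  have st: "fds_nth (\<Prod>n=2..M. F n) N = fds_nth (\<Prod>n=2..N. F n) N" if "N \<le> M" for M
    using that
  proof (induction M rule: dec_induct)
    case (step M)
    show ?case
    proof (cases "M = 0")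
      case nz: False
      have "fds_nth ((\<Prod>n=2..M. F n) * F (Suc M)) N = fds_nth (\<Prod>n=2..M. F n) N"
        using step nz by (intro fds_nth_mult_one_below[of "Suc M"] F) auto
      then show ?thesis using step nz by (simp add: prod.nat_ivl_Suc')
    qed (use step in auto)
  qed simp
  have "(THE c. \<forall>\<^sub>F M in sequentially. fds_nth (\<Prod>n=2..M. F n) N = c) =
      fds_nth (\<Prod>n=2..N. F n) N"
  proof (rule the_equality)
    show ev: "\<forall>\<^sub>F M in sequentially. fds_nth (\<Prod>n=2..M. F n) N = fds_nth (\<Prod>n=2..N. F n) N"
      by (rule eventually_mono[OF eventually_ge_at_top[of N] st])
    fix c assume "\<forall>\<^sub>F M in sequentially. fds_nth (\<Prod>n=2..M. F n) N = c"
    with ev have "\<forall>\<^sub>F M in sequentially. c = fds_nth (\<Prod>n=2..N. F n) N"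
      by eventually_elim auto
    then show "c = fds_nth (\<Prod>n=2..N. F n) N" by simp
  qed
  then show ?thesis
    using False st[OF \<open>N \<le> M\<close>] by (simp only: fds_prod_ge2_def fds_nth_fds if_False)
qed simp


section \<open>Colored factorizations\<close>

text \<open>A colored part is a pair (value, color).\<close>

definition colored_factorizations :: "nat \<Rightarrow> nat \<Rightarrow> (nat \<times> nat) multiset set" where
  "colored_factorizations l n =
     {P. (\<forall>(d, c) \<in># P. d \<ge> 2 \<and> c \<in> {1..l}) \<and> (\<Prod>(d, c) \<in># P. d) = n}"

definition distinct_colored_factorizations :: "nat \<Rightarrow> nat \<Rightarrow> (nat \<times> nat) multiset set" where
  "distinct_colored_factorizations l n =
     {P \<in> colored_factorizations l n. \<forall>p. count P p \<le> 1}"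

text \<open>
  For positive l the counting functions are cardinalities; for negative l they are
  coefficients of formal products.  In the two-variable products the formal variable z is
  \<^term>\<open>fps_X\<close>, i.e. the Dirichlet coefficients are power series in z.  The values at n = 1,
  and at k = 0, are the boundary conventions.
\<close>

definition A_count :: "int \<Rightarrow> nat \<Rightarrow> int" where
  "A_count l n =
     (if n = 1 then 1
      else if l > 0 then int (card (colored_factorizations (nat l) n))
      else fds_nth (fds_prod_ge2 (\<lambda>m. (1 - fds_monom 1 m) powi (- l))) n)"

definition B_count :: "int \<Rightarrow> nat \<Rightarrow> int" where
  "B_count l n =
     (if n = 1 then 1
      else if l > 0 then int (card (distinct_colored_factorizations (nat l) n))
      else fds_nth (fds_prod_ge2 (\<lambda>m. (1 + fds_monom 1 m) powi l)) n)"

definition f_count :: "nat \<Rightarrow> int \<Rightarrow> nat \<Rightarrow> int" where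
  "f_count k l n =
     (if n = 1 then (if k = 0 then 1 else 0)
      else if k = 0 then 0
      else if l > 0 then int (card {P \<in> colored_factorizations (nat l) n. size P = k})
      else fps_nth (fds_nth (fds_prod_ge2 (\<lambda>m. (1 - fds_monom fps_X m) powi (- l))) n) k)"

definition g_count :: "nat \<Rightarrow> int \<Rightarrow> nat \<Rightarrow> int" where
  "g_count k l n =
     (if n = 1 then (if k = 0 then 1 else 0)
      else if k = 0 then 0
      else if l > 0 then int (card {P \<in> distinct_colored_factorizations (nat l) n. size P = k})
      else fps_nth (fds_nth (fds_prod_ge2 (\<lambda>m. (1 + fds_monom fps_X m) powi l)) n) k)"

end

theory Submission
  imports Defs
begin

text \<open>
  The idea is logarithmic differentiation.  The operator that multiplies the coefficient at
  \<open>n\<close> by \<open>log n\<close> is a derivation of the ring of Dirichlet series, because \<open>log\<close> turns products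
  into sums.  Applied to \<open>Q = \<Prod>m (1 - z m\<^sup>-\<^sup>s)\<^sup>e\<close> it gives \<open>-e Q \<Sum>m log m \<Sum>i z\<^sup>i m\<^sup>-\<^sup>i\<^sup>s\<close>, with \<open>i\<close>
  running from 1, and comparing coefficients at \<open>n\<close> yields a recurrence.  All four claims are
  instances of this one recurrence, \<open>log_recurrence\<close>: the parameter \<open>z\<close> is 1 for \<open>A\<close>, -1 for \<open>B\<close>,
  the formal variable for \<open>f\<close> and its negative for \<open>g\<close>; the factor in front of the sum is \<open>l\<close>
  for \<open>A\<close> and \<open>f\<close> and \<open>-l\<close> for \<open>B\<close> and \<open>g\<close>, which is where the signs \<open>(-1)\<^sup>i\<^sup>+\<^sup>1\<close> come from.

  The coefficients live in the integers or in power series over the integers, where there is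
  no logarithm.  But a derivation arises from every completely additive function \<open>v\<close>, so the
  recurrence is proved for all natural-number valued \<open>v\<close> at once.  The multiplicities of the
  primes are such functions, and \<open>log n\<close> is the combination of them with weights \<open>log p\<close>
  (lemma \<open>ln_identity_of_multiplicity_identity\<close>).

  For \<open>l < 0\<close> the recurrence comes from the product (\<open>log_recurrence_product\<close>).  For \<open>l > 0\<close>
  it comes from double counting (\<open>log_recurrence_factorization_gf\<close>): \<open>v n\<close> is the sum of
  \<open>v\<close> over the parts of any factorization \<open>P\<close> of \<open>n\<close>, and for a fixed part \<open>(d, c)\<close> the number of
  its occurrences, summed over all \<open>P\<close> with weight \<open>z ^ size P\<close>, satisfies a recursion from \<open>n\<close> to \<open>n / d\<close> obtained by
  removing one copy of the part.  That recursion has the same shape as the one for the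
  coefficients of \<open>z d\<^sup>-\<^sup>s Q / (1 - z d\<^sup>-\<^sup>s)\<close>, and both are solved by \<open>geometric_unfolding\<close>.
\<close>

section \<open>Completely additive functions and power divisors\<close>

definition completely_additive :: "(nat \<Rightarrow> nat) \<Rightarrow> bool" where
  "completely_additive v \<longleftrightarrow> (\<forall>a b. a > 0 \<longrightarrow> b > 0 \<longrightarrow> v (a * b) = v a + v b)"

lemma completely_additive_mult:
  "completely_additive v \<Longrightarrow> a > 0 \<Longrightarrow> b > 0 \<Longrightarrow> v (a * b) = v a + v b"
  by (simp add: completely_additive_def)

lemma completely_additive_1: "completely_additive v \<Longrightarrow> v 1 = 0"
  using completely_additive_mult[of v 1 1] by simp

lemma completely_additive_multiplicity:
  fixes p :: nat
  assumes "prime p"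
  shows "completely_additive (multiplicity p)"
  using assms by (auto simp: completely_additive_def prime_elem_multiplicity_mult_distrib)

definition power_divisors :: "nat \<Rightarrow> (nat \<times> nat) set" where
  "power_divisors n = {(d, i). d \<ge> 2 \<and> i \<ge> 1 \<and> d ^ i dvd n}"

lemma power_dvd_imp_less:
  fixes d i n :: nat
  assumes "d \<ge> 2" "d ^ i dvd n" "n > 0"
  shows "i < n"
proof -
  have "i < 2 ^ i" by simp
  also have "\<dots> \<le> d ^ i" using assms by (intro power_mono) auto
  also have "\<dots> \<le> n" using assms by (intro dvd_imp_le)
  finally show ?thesis .
qed

lemma div_power_pos:
  fixes d i n :: nat
  assumes "n > 0" "d ^ i dvd n"
  shows "n div d ^ i > 0"
  using assms by (auto simp: div_greater_zero_iff intro: dvd_imp_le gr0I)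

lemma finite_power_exponents:
  fixes d n :: nat
  assumes "d \<ge> 2" "n > 0"
  shows "finite {i. i \<ge> 1 \<and> d ^ i dvd n}"
  by (rule finite_subset[of _ "{..<n}"]) (use assms power_dvd_imp_less in auto)

lemma power_divisors_Sigma:
  assumes "n > 0"
  shows "power_divisors n = (SIGMA d:{2..n}. {i. i \<ge> 1 \<and> d ^ i dvd n})"
proof -
  have "d \<le> n" if "d ^ i dvd n" "i \<ge> 1" for d i :: nat
    using that assms by (meson dvd_imp_le dvd_power dvd_trans less_le_trans zero_less_one)
  then show ?thesis by (auto simp: power_divisors_def)
qed

lemma finite_power_divisors: "n > 0 \<Longrightarrow> finite (power_divisors n)"
  by (subst power_divisors_Sigma) (auto simp del: One_nat_def intro!: finite_SigmaI finite_power_exponents)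

lemma sum_power_divisors:
  "n > 0 \<Longrightarrow> (\<Sum>(d, i)\<in>power_divisors n. h d i) =
     (\<Sum>d=2..n. \<Sum>i | i \<ge> 1 \<and> d ^ i dvd n. h d i)"
  unfolding power_divisors_Sigma by (rule sum.Sigma[symmetric])
    (auto simp del: One_nat_def intro: finite_power_exponents)

text \<open>
  The coefficientwise form of \<open>G = z m\<^sup>-\<^sup>s (P + G)\<close>, whose solution is \<open>P\<close> times a geometric series.
  No series is involved in the statement, so that it also applies to counting functions.
\<close>

lemma geometric_unfolding:
  fixes G P :: "nat \<Rightarrow> 'a::comm_ring_1"
  assumes m: "m \<ge> 2" and "n > 0"
    and rec: "\<And>n. n > 0 \<Longrightarrow> G n = (if m dvd n then z * (P (n div m) + G (n div m)) else 0)"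
  shows "G n = (\<Sum>i | i \<ge> 1 \<and> m ^ i dvd n. z ^ i * P (n div m ^ i))"
  using \<open>n > 0\<close>
proof (induction n rule: less_induct)
  case (less n)
  show ?case
  proof (cases "m dvd n")
    case False
    then have none: "{i. i \<ge> 1 \<and> m ^ i dvd n} = {}"
      by (auto intro: dvd_trans[of m "m ^ i" for i])
    show ?thesis unfolding none using rec[OF less.prems] False by simp
  next
    case True
    then obtain q where q: "n = m * q" by auto
    then have q0: "q > 0" "q < n" using less.prems m by auto
    have set: "{i. i \<ge> 1 \<and> m ^ i dvd n} = insert 1 (Suc ` {i. i \<ge> 1 \<and> m ^ i dvd q})" (is "?L = ?R")
    proof (rule set_eqI)
      fix i show "i \<in> ?L \<longleftrightarrow> i \<in> ?R" using m q by (cases i) (auto simp: image_iff)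
    qed
    have "(\<Sum>i | i \<ge> 1 \<and> m ^ i dvd n. z ^ i * P (n div m ^ i)) =
          z * P q + (\<Sum>i | i \<ge> 1 \<and> m ^ i dvd q. z ^ Suc i * P (n div m ^ Suc i))"
      unfolding set using finite_power_exponents[OF m q0(1)] m q
      by (subst sum.insert) (auto simp: sum.reindex)
    also have "\<dots> = z * (P q + (\<Sum>i | i \<ge> 1 \<and> m ^ i dvd q. z ^ i * P (q div m ^ i)))"
      using m q by (simp add: distrib_left sum_distrib_left mult.assoc)
    also have "\<dots> = z * (P q + G q)" using less.IH[OF q0(2,1)] by simp
    also have "\<dots> = G n" using rec[OF less.prems] True q m by simp
    finally show ?thesis ..
  qed
qed

section \<open>Logarithmic differentiation of products\<close>

text \<open>
  The coefficient form of \<open>D S = e S \<Sum>d v(d) z d\<^sup>-\<^sup>s / (1 - z d\<^sup>-\<^sup>s)\<close>, where \<open>D\<close> is the derivation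
  belonging to \<open>v\<close>.  Quantifying over \<open>v\<close> inside makes it possible to use all primes later.
\<close>

definition log_recurrence :: "int \<Rightarrow> 'a::comm_ring_1 \<Rightarrow> (nat \<Rightarrow> 'a) \<Rightarrow> bool" where
  "log_recurrence e z S \<longleftrightarrow> (\<forall>v n. completely_additive v \<longrightarrow> n > 0 \<longrightarrow>
     of_nat (v n) * S n =
       of_int e * (\<Sum>(d, i)\<in>power_divisors n. of_nat (v d) * (z ^ i * S (n div d ^ i))))"

lemma fds_nth_of_nat_mult: "fds_nth (of_nat c * f) n = of_nat c * fds_nth f n"
  by (induction c) (simp_all add: fds_nth_ring_ops distrib_right)

lemma fds_nth_of_int_mult: "fds_nth (of_int c * f) n = of_int c * fds_nth f n"
  by (cases c rule: int_diff_cases) (simp add: fds_nth_ring_ops left_diff_distrib fds_nth_of_nat_mult)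

lemma fds_nth_sum: "fds_nth (sum f A) n = (\<Sum>x\<in>A. fds_nth (f x) n)"
  by (induction A rule: infinite_finite_induct) (simp_all add: fds_nth_ring_ops)

lemma fds_nth_monom_mult:
  fixes c :: "'a::comm_ring_1"
  assumes "m > 0" "n > 0"
  shows "fds_nth (fds_monom c m * f) n = (if m dvd n then c * fds_nth f (n div m) else 0)"
proof -
  have "fds_nth (fds_monom c m * f) n =
        (\<Sum>p \<in> (if m dvd n then {(m, n div m)} else {}). fds_nth (fds_monom c m) (fst p) * fds_nth f (snd p))"
    unfolding fds_nth_mult[OF \<open>n > 0\<close>] case_prod_unfold
    using finite_mult_pairs[OF \<open>n > 0\<close>] assms
    by (intro sum.mono_neutral_right) (auto simp: fds_monom_def fds_nth_fds case_prod_unfold split: if_splits)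
  then show ?thesis using assms by (simp add: fds_monom_def fds_nth_fds)
qed

definition fds_deriv :: "(nat \<Rightarrow> nat) \<Rightarrow> 'a::comm_ring_1 fds \<Rightarrow> 'a fds" where
  "fds_deriv v f = fds (\<lambda>n. of_nat (v n) * fds_nth f n)"

lemma fds_nth_deriv: "fds_nth (fds_deriv v f) n = of_nat (v n) * fds_nth f n"
  by (simp add: fds_deriv_def fds_nth_fds)

lemma fds_deriv_mult:
  assumes "completely_additive v"
  shows "fds_deriv v (f * g) = fds_deriv v f * g + f * fds_deriv v g"
proof (rule fds_eqI)
  fix n :: nat assume n: "n > 0"
  show "fds_nth (fds_deriv v (f * g)) n = fds_nth (fds_deriv v f * g + f * fds_deriv v g) n"
    unfolding fds_nth_ring_ops fds_nth_deriv fds_nth_mult[OF n] sum_distrib_left sum.distrib[symmetric]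
  proof (intro sum.cong refl)
    fix p assume "p \<in> {(a, b). a * b = n}"
    then obtain a b where p: "p = (a, b)" "a * b = n" by auto
    then have "v n = v a + v b"
      using n completely_additive_mult[OF assms, of a b] by auto
    then show "of_nat (v n) * (case p of (a, b) \<Rightarrow> fds_nth f a * fds_nth g b) =
      (case p of (a, b) \<Rightarrow> of_nat (v a) * fds_nth f a * fds_nth g b) +
      (case p of (a, b) \<Rightarrow> fds_nth f a * (of_nat (v b) * fds_nth g b))"
      by (simp add: p algebra_simps)
  qed
qed

lemma fds_deriv_1: "completely_additive v \<Longrightarrow> fds_deriv v 1 = 0"
  by (rule fds_eqI) (auto simp: fds_nth_deriv fds_nth_ring_ops completely_additive_1[of v, simplified])

lemma fds_deriv_prod:
  assumes v: "completely_additive v" and "\<And>x. x \<in> A \<Longrightarrow> fds_deriv v (f x) = g x * f x"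
  shows "fds_deriv v (prod f A) = sum g A * prod f A"
  using assms(2)
  by (induction A rule: infinite_finite_induct)
     (simp_all add: fds_deriv_1[OF v] fds_deriv_mult[OF v] algebra_simps)

text \<open>
  The logarithmic derivative \<open>g\<close> of \<open>f\<close> is specified by \<open>D f = g f\<close> instead of by a quotient;
  in this form products and powers need no division, and the inverse of \<open>f\<close> has the
  logarithmic derivative \<open>-g\<close>.
\<close>

lemma fds_deriv_powi:
  assumes v: "completely_additive v" and f: "fds_deriv v f = g * f" and unit: "f dvd 1"
  shows "fds_deriv v (f powi e) = of_int e * g * f powi e"
proof -
  have pow: "fds_deriv v (h ^ i) = of_nat i * g' * h ^ i" if "fds_deriv v h = g' * h" for h g' i
    using fds_deriv_prod[OF v, of "{..<i}" "\<lambda>_. h" "\<lambda>_. g'"] that by simp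
  have "inverse f * (fds_deriv v f * inverse f + f * fds_deriv v (inverse f)) = 0"
    using fds_mult_inverse[OF unit] fds_deriv_mult[OF v, of f "inverse f"] by (simp add: fds_deriv_1[OF v])
  then have "(f * inverse f) * (g * inverse f + fds_deriv v (inverse f)) = 0"
    unfolding f by (simp add: algebra_simps)
  then have "fds_deriv v (inverse f) = - g * inverse f"
    by (simp add: fds_mult_inverse[OF unit] eq_neg_iff_add_eq_0 add.commute)
  then show ?thesis
    using pow[OF f, of "nat e"] pow[of "inverse f" "- g" "nat (- e)"]
    by (cases "e \<ge> 0") (simp_all add: power_int_def)
qed

lemma fds_deriv_one_minus_monom:
  assumes "completely_additive v"
  shows "fds_deriv v (1 - fds_monom z m) = - (of_nat (v m) * fds_monom z m)"
  using completely_additive_1[OF assms]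
  by (intro fds_eqI)
     (auto simp: fds_nth_deriv fds_nth_ring_ops fds_nth_of_nat_mult fds_monom_def fds_nth_fds)

text \<open>
  The coefficients up to \<open>n\<close> of the infinite product are those of the partial product up to \<open>n\<close>,
  so differentiating a finite product is enough for the recurrence at \<open>n\<close>.
\<close>

lemma log_recurrence_product:
  fixes z :: "'a::comm_ring_1"
  shows "log_recurrence (- e) z (fds_nth (fds_prod_ge2 (\<lambda>m. (1 - fds_monom z m) powi e)))"
  unfolding log_recurrence_def
proof (intro allI impI)
  fix v and n :: nat
  assume v: "completely_additive v" and n: "n > 0"
  define F where "F = (\<lambda>m. 1 - fds_monom z m)"
  define Q where "Q = (\<Prod>m=2..n. F m powi e)"
  \<comment> \<open>the \<open>m\<close>-th summand of the derivative of \<open>Q\<close>, up to the factor \<open>-e v(m)\<close>\<close>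
  define G where "G = (\<lambda>m. inverse (F m) * (fds_monom z m * Q))"
  have unit: "F m dvd 1" if "m \<ge> 2" for m
    by (rule fds_unit) (use that in \<open>simp add: F_def fds_nth_ring_ops fds_monom_def fds_nth_fds\<close>)
  have stat: "fds_nth (fds_prod_ge2 (\<lambda>m. F m powi e)) N = fds_nth Q N" if "N \<le> n" for N
    unfolding Q_def
    by (rule fds_prod_ge2_stationary) (use that fds_binomial_powi_one_below in \<open>auto simp: F_def\<close>)
  have log_deriv: "fds_deriv v (F m) = - (of_nat (v m) * fds_monom z m * inverse (F m)) * F m"
    if "m \<ge> 2" for m
  proof -
    have "fds_deriv v (F m) = - (of_nat (v m) * fds_monom z m) * (F m * inverse (F m))"
      using fds_deriv_one_minus_monom[OF v, of z m] fds_mult_inverse[OF unit[OF that]]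
      by (simp add: F_def)
    then show ?thesis by (simp add: algebra_simps)
  qed
  have "fds_deriv v Q = (\<Sum>m=2..n. of_int e * - (of_nat (v m) * fds_monom z m * inverse (F m))) * Q"
    unfolding Q_def
    by (rule fds_deriv_prod[OF v], rule fds_deriv_powi[OF v]) (use log_deriv unit in auto)
  also have "\<dots> = of_int (- e) * (\<Sum>m=2..n. of_nat (v m) * G m)"
    by (simp add: G_def sum_distrib_right sum_distrib_left sum_negf[symmetric] mult_ac)
  finally have deriv: "fds_deriv v Q = of_int (- e) * (\<Sum>m=2..n. of_nat (v m) * G m)" .
  have coeff: "fds_nth (G m) n = (\<Sum>i | i \<ge> 1 \<and> m ^ i dvd n. z ^ i * fds_nth Q (n div m ^ i))"
    if m: "m \<ge> 2" for m
  proof (rule geometric_unfolding[OF m n])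
    fix N :: nat assume N: "N > 0"
    have "G m = (F m * inverse (F m)) * (fds_monom z m * Q) + fds_monom z m * G m"
      by (simp add: G_def F_def algebra_simps)
    then have "G m = fds_monom z m * (Q + G m)"
      by (simp add: fds_mult_inverse[OF unit[OF m]] algebra_simps)
    then have "fds_nth (G m) N = fds_nth (fds_monom z m * (Q + G m)) N" by simp
    also have "\<dots> = (if m dvd N then z * (fds_nth Q (N div m) + fds_nth (G m) (N div m)) else 0)"
      using m N by (subst fds_nth_monom_mult) (auto simp: fds_nth_ring_ops)
    finally show "fds_nth (G m) N =
        (if m dvd N then z * (fds_nth Q (N div m) + fds_nth (G m) (N div m)) else 0)" .
  qed
  have "of_nat (v n) * fds_nth Q n = fds_nth (fds_deriv v Q) n"
    by (simp add: fds_nth_deriv)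
  also have "\<dots> = of_int (- e) * (\<Sum>m=2..n. of_nat (v m) * fds_nth (G m) n)"
    unfolding deriv fds_nth_of_int_mult fds_nth_sum fds_nth_of_nat_mult ..
  also have "\<dots> = of_int (- e) *
      (\<Sum>(m, i)\<in>power_divisors n. of_nat (v m) * (z ^ i * fds_nth Q (n div m ^ i)))"
    unfolding sum_power_divisors[OF n] by (simp add: coeff sum_distrib_left)
  finally have "of_nat (v n) * fds_nth Q n = of_int (- e) *
      (\<Sum>(m, i)\<in>power_divisors n. of_nat (v m) * (z ^ i * fds_nth Q (n div m ^ i)))" .
  then show "of_nat (v n) * fds_nth (fds_prod_ge2 (\<lambda>m. (1 - fds_monom z m) powi e)) n =
      of_int (- e) * (\<Sum>(m, i)\<in>power_divisors n. of_nat (v m) *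
        (z ^ i * fds_nth (fds_prod_ge2 (\<lambda>m. (1 - fds_monom z m) powi e)) (n div m ^ i)))"
    using stat by (simp add: F_def)
qed

section \<open>Double counting of parts\<close>

definition parts_upto :: "nat \<Rightarrow> nat \<Rightarrow> (nat \<times> nat) set" where
  "parts_upto l n = {2..n} \<times> {1..l}"

text \<open>
  Weighting by \<open>z ^ size P\<close> treats both kinds of counts together: \<open>z = 1\<close> counts all
  factorizations, and the formal variable of power series counts them by their number of parts.
\<close>

definition factorization_gf :: "'a::comm_ring_1 \<Rightarrow> (nat \<Rightarrow> (nat \<times> nat) multiset set) \<Rightarrow> nat \<Rightarrow> 'a" where
  "factorization_gf z C n = (\<Sum>P\<in>C n. z ^ size P)"

definition part_gf ::
  "'a::comm_ring_1 \<Rightarrow> (nat \<Rightarrow> (nat \<times> nat) multiset set) \<Rightarrow> nat \<times> nat \<Rightarrow> nat \<Rightarrow> 'a" where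
  "part_gf z C p n = (\<Sum>P\<in>C n. of_nat (count P p) * z ^ size P)"

lemma colored_factorizations_add_mset:
  assumes "d \<ge> 2" "c \<in> {1..l}"
  shows "add_mset (d, c) P \<in> colored_factorizations l (d * n) \<longleftrightarrow> P \<in> colored_factorizations l n"
  using assms by (auto simp: colored_factorizations_def)

lemma colored_factorizations_part:
  assumes "P \<in> colored_factorizations l n" "(d, c) \<in># P"
  shows "d \<ge> 2" "c \<in> {1..l}" "d dvd n" 
    "P - {#(d, c)#} \<in> colored_factorizations l (n div d)" "n > 0 \<Longrightarrow> d \<le> n"
proof -
  show d: "d \<ge> 2" and c: "c \<in> {1..l}" using assms by (auto simp: colored_factorizations_def)
  obtain P' where P': "P = add_mset (d, c) P'" using assms(2) by (metis multi_member_split)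
  then show dvd: "d dvd n" using assms(1) by (auto simp: colored_factorizations_def)
  then obtain m where m: "n = d * m" by auto
  show "P - {#(d, c)#} \<in> colored_factorizations l (n div d)"
    using assms(1) d colored_factorizations_add_mset[OF d c] by (simp add: P' m)
  show "d \<le> n" if "n > 0" using dvd that by (rule dvd_imp_le)
qed

lemma colored_factorizations_1: "colored_factorizations l 1 = {{#}}"
proof -
  have "P = {#}" if P: "P \<in> colored_factorizations l 1" for P
  proof (rule ccontr)
    assume "P \<noteq> {#}"
    then obtain d c where dc: "(d, c) \<in># P" by (metis multiset_nonemptyE surj_pair)
    show False using colored_factorizations_part[OF P dc] by simp
  qed
  then show ?thesis by (auto simp: colored_factorizations_def)
qed

text \<open>Removing a part leads to a proper divisor, so finiteness follows by induction.\<close>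

lemma finite_colored_factorizations: "n > 0 \<Longrightarrow> finite (colored_factorizations l n)"
proof (induction n rule: less_induct)
  case (less n)
  have "P \<in> insert {#} (\<Union>(d, c)\<in>parts_upto l n. add_mset (d, c) ` colored_factorizations l (n div d))"
    if P: "P \<in> colored_factorizations l n" for P
  proof (cases "P = {#}")
    case False
    then obtain d c where dc: "(d, c) \<in># P" by (metis multiset_nonemptyE surj_pair)
    have "P = add_mset (d, c) (P - {#(d, c)#})" using dc by simp
    moreover have "(d, c) \<in> parts_upto l n"
      using colored_factorizations_part[OF P dc] less.prems by (simp add: parts_upto_def)
    ultimately show ?thesis using colored_factorizations_part(4)[OF P dc] by blast
  qed simp
  moreover have "finite (insert {#}
      (\<Union>(d, c)\<in>parts_upto l n. add_mset (d, c) ` colored_factorizations l (n div d)))"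
    using less.prems
    by (auto simp: parts_upto_def div_greater_zero_iff intro!: less.IH div_less_dividend)
  ultimately show ?case by (meson finite_subset subsetI)
qed

lemma completely_additive_prod_mset:
  assumes v: "completely_additive v" and P: "P \<in> colored_factorizations l n" and n: "n > 0"
  shows "v n = (\<Sum>p\<in>parts_upto l n. count P p * v (fst p))"
proof -
  have "v (\<Prod>(d, c)\<in>#M. d) = (\<Sum>p\<in>A. count M p * v (fst p))"
    if "finite A" "set_mset M \<subseteq> A" "\<And>p. p \<in># M \<Longrightarrow> fst p > 0" for A and M :: "(nat \<times> nat) multiset"
    using that
  proof (induction M)
    case empty
    then show ?case using completely_additive_1[OF v] by simp
  next
    case (add p M)
    have pos: "(\<Prod>(d, c)\<in>#M. d) > 0"
    proof (rule gr0I)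
      assume "(\<Prod>(d, c)\<in>#M. d) = 0"
      then obtain q where "q \<in># M" "fst q = 0" by (auto simp: case_prod_unfold)
      then show False using add.prems(3)[of q] by simp
    qed
    have "v (\<Prod>(d, c)\<in>#add_mset p M. d) = v (fst p) + v (\<Prod>(d, c)\<in>#M. d)"
      using completely_additive_mult[OF v _ pos, of "fst p"] add.prems(3) by (simp add: case_prod_unfold)
    also have "\<dots> = (\<Sum>q\<in>A. (if q = p then v (fst q) else 0)) + (\<Sum>q\<in>A. count M q * v (fst q))"
      using add by simp
    also have "\<dots> = (\<Sum>q\<in>A. count (add_mset p M) q * v (fst q))"
      unfolding sum.distrib[symmetric] by (intro sum.cong) auto
    finally show ?case .
  qed
  moreover have "set_mset P \<subseteq> parts_upto l n"
    using colored_factorizations_part(1,2,5)[OF P] n by (auto simp: parts_upto_def simp del: One_nat_def)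
  moreover have "fst p > 0" if "p \<in># P" for p
    using colored_factorizations_part(1)[OF P, of "fst p" "snd p"] that by simp
  ultimately have "v (\<Prod>(d, c)\<in>#P. d) = (\<Sum>p\<in>parts_upto l n. count P p * v (fst p))"
    by (simp add: parts_upto_def)
  then show ?thesis using P by (simp add: colored_factorizations_def)
qed

text \<open>
  The sign \<open>s\<close> tells the two kinds of factorizations apart.  After one copy of the part \<open>(d, c)\<close>
  is removed, the remaining copies are still to be counted if repetitions are allowed
  (\<open>s = 1\<close>); if they are not, the factorizations that still contain the part have to be
  subtracted (\<open>s = -1\<close>).  Multiplying the recursion by \<open>s\<close> turns it into a geometric one with
  ratio \<open>s z\<close>.  Its solution does not depend on the color \<open>c\<close>, which yields the factor \<open>l\<close>.
\<close>

lemma log_recurrence_factorization_gf: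
  fixes z s :: "'a::comm_ring_1"
  assumes sub: "\<And>n. C n \<subseteq> colored_factorizations l n"
    and e: "of_int e = of_nat l * s" and s: "s * s = 1"
    and rec: "\<And>d c n. d \<ge> 2 \<Longrightarrow> c \<in> {1..l} \<Longrightarrow> n > 0 \<Longrightarrow>
      part_gf z C (d, c) (d * n) = z * (factorization_gf z C n + s * part_gf z C (d, c) n)"
  shows "log_recurrence e (s * z) (factorization_gf z C)"
  unfolding log_recurrence_def
proof (intro allI impI)
  fix v and n :: nat
  assume v: "completely_additive v" and n: "n > 0"
  let ?W = "factorization_gf z C"
  define T where "T = (\<lambda>d. \<Sum>i | i \<ge> 1 \<and> d ^ i dvd n. (s * z) ^ i * ?W (n div d ^ i))"
  have part: "part_gf z C (d, c) n = s * T d" if d: "d \<ge> 2" and c: "c \<in> {1..l}" for d c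
  proof -
    have "s * part_gf z C (d, c) n = T d"
      unfolding T_def
    proof (rule geometric_unfolding[OF d n, where G = "\<lambda>n. s * part_gf z C (d, c) n"])
      fix N :: nat assume N: "N > 0"
      show "s * part_gf z C (d, c) N = (if d dvd N
          then s * z * (?W (N div d) + s * part_gf z C (d, c) (N div d)) else 0)"
      proof (cases "d dvd N")
        case True
        then obtain m where m: "N = d * m" by auto
        then show ?thesis using rec[OF d c, of m] N d by (simp add: mult.assoc)
      next
        case False
        then have "count P (d, c) = 0" if "P \<in> C N" for P
          using sub that colored_factorizations_part(3) by (meson not_in_iff subsetD)
        then show ?thesis using False by (simp add: part_gf_def)
      qed
    qed
    then have "(s * s) * part_gf z C (d, c) n = s * T d" by (simp only: mult.assoc)
    then show ?thesis by (simp add: s)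
  qed
  have "of_nat (v n) * ?W n =
      (\<Sum>P\<in>C n. \<Sum>p\<in>parts_upto l n. of_nat (v (fst p)) * (of_nat (count P p) * z ^ size P))"
    unfolding factorization_gf_def sum_distrib_left
  proof (intro sum.cong refl)
    fix P assume "P \<in> C n"
    then have "v n = (\<Sum>p\<in>parts_upto l n. count P p * v (fst p))"
      using completely_additive_prod_mset[OF v _ n] sub by blast
    then show "of_nat (v n) * z ^ size P =
        (\<Sum>p\<in>parts_upto l n. of_nat (v (fst p)) * (of_nat (count P p) * z ^ size P))"
      by (simp add: sum_distrib_right sum_distrib_left mult_ac)
  qed
  also have "\<dots> = (\<Sum>p\<in>parts_upto l n. of_nat (v (fst p)) * part_gf z C p n)"
    unfolding part_gf_def sum_distrib_left by (rule sum.swap)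
  also have "\<dots> = (\<Sum>d=2..n. \<Sum>c=1..l. of_nat (v d) * part_gf z C (d, c) n)"
    unfolding parts_upto_def by (subst sum.cartesian_product) (simp add: case_prod_unfold)
  also have "\<dots> = (\<Sum>d=2..n. \<Sum>c=1..l. of_nat (v d) * (s * T d))"
    by (intro sum.cong refl) (auto simp: part)
  also have "\<dots> = of_int e * (\<Sum>d=2..n. of_nat (v d) * T d)"
    by (simp add: e sum_distrib_left mult_ac)
  also have "(\<Sum>d=2..n. of_nat (v d) * T d) =
      (\<Sum>(d, i)\<in>power_divisors n. of_nat (v d) * ((s * z) ^ i * ?W (n div d ^ i)))"
    by (simp only: sum_power_divisors[OF n] T_def sum_distrib_left)
  finally show "of_nat (v n) * ?W n = of_int e *
      (\<Sum>(d, i)\<in>power_divisors n. of_nat (v d) * ((s * z) ^ i * ?W (n div d ^ i)))" .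
qed

lemma log_recurrence_colored:
  "log_recurrence (int l) z (factorization_gf z (colored_factorizations l))"
proof -
  let ?C = "colored_factorizations l"
  have "log_recurrence (int l) (1 * z) (factorization_gf z ?C)"
  proof (rule log_recurrence_factorization_gf)
    fix d c n :: nat
    assume d: "d \<ge> 2" and c: "c \<in> {1..l}" and n: "n > 0"
    have "part_gf z ?C (d, c) (d * n) =
        (\<Sum>P\<in>add_mset (d, c) ` ?C n. of_nat (count P (d, c)) * z ^ size P)"
      unfolding part_gf_def
    proof (rule sum.mono_neutral_right)
      show "finite (?C (d * n))" using d n by (intro finite_colored_factorizations) simp
      show "add_mset (d, c) ` ?C n \<subseteq> ?C (d * n)" using colored_factorizations_add_mset[OF d c] by auto
      have "P \<in> add_mset (d, c) ` ?C n" if "P \<in> ?C (d * n)" "(d, c) \<in># P" for P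
        using colored_factorizations_part(4)[OF that] d that(2)
        by (intro image_eqI[of _ _ "P - {#(d, c)#}"]) auto
      then have "count P (d, c) = 0" if "P \<in> ?C (d * n) - add_mset (d, c) ` ?C n" for P
        using that by (meson DiffE not_in_iff)
      then show "\<forall>P\<in>?C (d * n) - add_mset (d, c) ` ?C n. of_nat (count P (d, c)) * z ^ size P = 0"
        by (intro ballI) (simp only: of_nat_0 mult_zero_left)
    qed
    also have "\<dots> = (\<Sum>P\<in>?C n. z * (z ^ size P + 1 * (of_nat (count P (d, c)) * z ^ size P)))"
      by (subst sum.reindex) (auto simp: inj_on_def algebra_simps intro!: sum.cong)
    also have "\<dots> = z * (factorization_gf z ?C n + 1 * part_gf z ?C (d, c) n)"
      unfolding factorization_gf_def part_gf_def sum_distrib_left sum.distrib[symmetric] ..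
    finally show "part_gf z ?C (d, c) (d * n) = z * (factorization_gf z ?C n + 1 * part_gf z ?C (d, c) n)" .
  qed auto
  then show ?thesis by simp
qed

lemma log_recurrence_distinct:
  "log_recurrence (- int l) (- z) (factorization_gf z (distinct_colored_factorizations l))"
proof -
  let ?C = "distinct_colored_factorizations l"
  have fin: "finite (?C n)" if "n > 0" for n
    using finite_colored_factorizations[OF that] by (simp add: distinct_colored_factorizations_def)
  have "log_recurrence (- int l) (- 1 * z) (factorization_gf z ?C)"
  proof (rule log_recurrence_factorization_gf)
    show "?C n \<subseteq> colored_factorizations l n" for n
      by (auto simp: distinct_colored_factorizations_def)
    fix d c n :: nat
    assume d: "d \<ge> 2" and c: "c \<in> {1..l}" and n: "n > 0"
    let ?N = "{P \<in> ?C n. (d, c) \<notin># P}"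
    have "part_gf z ?C (d, c) (d * n) =
        (\<Sum>P\<in>add_mset (d, c) ` ?N. of_nat (count P (d, c)) * z ^ size P)"
      unfolding part_gf_def
    proof (rule sum.mono_neutral_right)
      show "finite (?C (d * n))" using d n by (intro fin) simp
      show "add_mset (d, c) ` ?N \<subseteq> ?C (d * n)"
        using colored_factorizations_add_mset[OF d c]
        by (auto simp: distinct_colored_factorizations_def not_in_iff)
      have "P \<in> add_mset (d, c) ` ?N" if P: "P \<in> ?C (d * n)" "(d, c) \<in># P" for P
      proof (rule image_eqI)
        show "P = add_mset (d, c) (P - {#(d, c)#})" using P(2) by simp
        have P': "P \<in> colored_factorizations l (d * n)" "\<And>p. count P p \<le> 1"
          using P(1) by (auto simp: distinct_colored_factorizations_def)
        have "count (P - {#(d, c)#}) p \<le> 1" for p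
          using P'(2)[of p] by simp
        moreover have "count (P - {#(d, c)#}) (d, c) = 0"
          using P'(2)[of "(d, c)"] by simp
        ultimately show "P - {#(d, c)#} \<in> ?N"
          using colored_factorizations_part(4)[OF P'(1) P(2)] d
          by (simp add: distinct_colored_factorizations_def not_in_iff del: count_diff)
      qed
      then have "count P (d, c) = 0" if "P \<in> ?C (d * n) - add_mset (d, c) ` ?N" for P
        using that by (meson DiffE not_in_iff)
      then show "\<forall>P\<in>?C (d * n) - add_mset (d, c) ` ?N. of_nat (count P (d, c)) * z ^ size P = 0"
        by (intro ballI) (simp only: of_nat_0 mult_zero_left)
    qed
    also have "\<dots> = (\<Sum>P\<in>?N. z * z ^ size P)"
      by (subst sum.reindex) (auto simp: inj_on_def not_in_iff intro!: sum.cong)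
    also have "\<dots> = (\<Sum>P\<in>?C n. z * (z ^ size P + - 1 * (of_nat (count P (d, c)) * z ^ size P)))"
    proof (rule sum.mono_neutral_cong_left)
      show "\<forall>P\<in>?C n - ?N. z * (z ^ size P + - 1 * (of_nat (count P (d, c)) * z ^ size P)) = 0"
      proof
        fix P assume "P \<in> ?C n - ?N"
        then have "count P (d, c) > 0" "count P (d, c) \<le> 1"
          by (auto simp: distinct_colored_factorizations_def)
        then have "count P (d, c) = 1" by linarith
        then show "z * (z ^ size P + - 1 * (of_nat (count P (d, c)) * z ^ size P)) = 0" by simp
      qed
    next
      show "z * z ^ size P = z * (z ^ size P + - 1 * (of_nat (count P (d, c)) * z ^ size P))"
        if "P \<in> ?N" for P
      proof -
        have "count P (d, c) = 0" using that unfolding not_in_iff[symmetric] by blast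
        then show ?thesis by simp
      qed
    qed (use fin[OF n] in auto)
    also have "\<dots> = z * (factorization_gf z ?C n + - 1 * part_gf z ?C (d, c) n)"
      unfolding factorization_gf_def part_gf_def sum_distrib_left sum.distrib[symmetric] ..
    finally show "part_gf z ?C (d, c) (d * n) = z * (factorization_gf z ?C n + - 1 * part_gf z ?C (d, c) n)" .
  qed auto
  then show ?thesis by simp
qed

section \<open>The four counting functions\<close>

lemma factorization_gf_1:
  "factorization_gf z (colored_factorizations l) 1 = 1"
  "factorization_gf z (distinct_colored_factorizations l) 1 = 1"
proof -
  have "distinct_colored_factorizations l 1 = {{#}}"
    by (auto simp: distinct_colored_factorizations_def colored_factorizations_1[simplified])
  then show "factorization_gf z (distinct_colored_factorizations l) 1 = 1"
    by (simp add: factorization_gf_def)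
qed (simp add: factorization_gf_def colored_factorizations_1[simplified])

lemma product_nth_1:
  "fds_nth (fds_prod_ge2 (\<lambda>m. (1 - fds_monom z m) powi e)) 1 = (1 :: 'a::comm_ring_1)"
  by (subst fds_prod_ge2_stationary[where M = 1])
     (simp_all add: fds_binomial_powi_one_below fds_nth_ring_ops)

lemma log_recurrence_cong:
  assumes "log_recurrence e z S" and "\<And>n. n > 0 \<Longrightarrow> S n = T n"
  shows "log_recurrence e z T"
proof -
  have "S (n div d ^ i) = T (n div d ^ i)" if "(d, i) \<in> power_divisors n" "n > 0" for d i n
    using that div_power_pos by (intro assms(2)) (auto simp: power_divisors_def)
  then have "(\<Sum>(d, i)\<in>power_divisors n. of_nat (v d) * (z ^ i * S (n div d ^ i))) =
      (\<Sum>(d, i)\<in>power_divisors n. of_nat (v d) * (z ^ i * T (n div d ^ i)))" if "n > 0" for n v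
    using that by (intro sum.cong) auto
  then show ?thesis using assms by (simp add: log_recurrence_def)
qed

lemma log_recurrence_A_count: "log_recurrence l 1 (A_count l)"
proof (cases "l > 0")
  case True
  have "factorization_gf 1 (colored_factorizations (nat l)) n = A_count l n" for n
    using True factorization_gf_1(1)[of "1 :: int" "nat l"] by (simp add: A_count_def factorization_gf_def)
  then show ?thesis
    using log_recurrence_colored[of "nat l" 1] True by (auto intro: log_recurrence_cong)
next
  case False
  have "fds_nth (fds_prod_ge2 (\<lambda>m. (1 - fds_monom 1 m) powi (- l))) n = A_count l n" for n
    using False product_nth_1[of "1 :: int" "- l"] by (simp add: A_count_def)
  then show ?thesis
    using log_recurrence_product[of "- l" 1] by (auto intro: log_recurrence_cong)
qed

text \<open>
  By this identity the products for distinct factorizations are the products for unrestricted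
  ones with both \<open>z\<close> and \<open>l\<close> negated.
\<close>

lemma one_plus_monom: "1 + fds_monom c m = 1 - fds_monom (- c :: 'a::comm_ring_1) m"
  by (rule fds_eqI) (simp add: fds_nth_ring_ops fds_monom_def fds_nth_fds)

lemma log_recurrence_B_count: "log_recurrence (- l) (- 1) (B_count l)"
proof (cases "l > 0")
  case True
  have "factorization_gf 1 (distinct_colored_factorizations (nat l)) n = B_count l n" for n
    using True factorization_gf_1(2)[of "1 :: int" "nat l"] by (simp add: B_count_def factorization_gf_def)
  then show ?thesis
    using log_recurrence_distinct[of "nat l" 1] True by (auto intro: log_recurrence_cong)
next
  case False
  have "fds_nth (fds_prod_ge2 (\<lambda>m. (1 - fds_monom (- 1) m) powi l)) n = B_count l n" for n
    using False product_nth_1[of "- 1 :: int" l] by (simp add: B_count_def one_plus_monom)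
  then show ?thesis
    using log_recurrence_product[of l "- 1"] by (auto intro: log_recurrence_cong)
qed

text \<open>
  This is the convention that there is no factorization of \<open>n \<ge> 2\<close> into 0 parts, for the
  coefficients of the products.  In the recurrence for a prime divisor \<open>p\<close> of \<open>n\<close> the right
  side has no constant term, and the factor \<open>multiplicity p n\<close> on the left is positive.
\<close>

lemma log_recurrence_constant_term:
  fixes S :: "nat \<Rightarrow> int fps"
  assumes S: "log_recurrence e z S" and z: "fps_nth z 0 = 0" and n: "n \<ge> 2"
  shows "fps_nth (S n) 0 = 0"
proof -
  obtain p where p: "prime p" "p dvd n" using n prime_factor_nat[of n] by auto
  have "of_nat (multiplicity p n) * S n = of_int e *
      (\<Sum>(d, i)\<in>power_divisors n. of_nat (multiplicity p d) * (z ^ i * S (n div d ^ i)))"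
    using S completely_additive_multiplicity[OF p(1)] n by (auto simp: log_recurrence_def)
  then have "fps_nth (of_nat (multiplicity p n) * S n) 0 = fps_nth (of_int e *
      (\<Sum>(d, i)\<in>power_divisors n. of_nat (multiplicity p d) * (z ^ i * S (n div d ^ i)))) 0"
    by simp
  also have "\<dots> = 0"
    using z by (auto simp: fps_sum_nth power_divisors_def fps_nth_power_0 intro!: sum.neutral)
  finally have "int (multiplicity p n) * fps_nth (S n) 0 = 0" by simp
  moreover have "multiplicity p n > 0"
    using p n by (intro prime_multiplicity_gt_zero_iff[THEN iffD2]) auto
  ultimately show ?thesis by simp
qed

lemma factorization_gf_X_nth:
  fixes C :: "nat \<Rightarrow> (nat \<times> nat) multiset set"
  assumes "finite (C n)"
  shows "fps_nth (factorization_gf (fps_X :: int fps) C n) k = int (card {P \<in> C n. size P = k})"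
proof -
  have "fps_nth (factorization_gf (fps_X :: int fps) C n) k = (\<Sum>P\<in>C n. if size P = k then 1 else 0)"
    unfolding factorization_gf_def fps_sum_nth by (intro sum.cong) auto
  also have "\<dots> = int (card {P \<in> C n. size P = k})"
    by (subst sum.inter_filter[OF assms, symmetric]) simp
  finally show ?thesis .
qed

lemma f_count_series:
  "\<exists>S. log_recurrence l fps_X S \<and> (\<forall>n k. n > 0 \<longrightarrow> f_count k l n = fps_nth (S n) k)"
proof -
  define S where "S = (\<lambda>n. if l > 0 then factorization_gf (fps_X :: int fps) (colored_factorizations (nat l)) n
      else fds_nth (fds_prod_ge2 (\<lambda>m. (1 - fds_monom fps_X m) powi (- l))) n)"
  have rec: "log_recurrence l fps_X S"
    using log_recurrence_colored[of "nat l" "fps_X :: int fps"]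
      log_recurrence_product[of "- l" "fps_X :: int fps"]
    by (cases "l > 0") (simp_all add: S_def)
  have "f_count k l n = fps_nth (S n) k" if n: "n > 0" for n k
  proof (cases "n = 1")
    case True
    then show ?thesis
      using factorization_gf_1(1)[of "fps_X :: int fps"] product_nth_1[of "fps_X :: int fps"]
      by (simp add: f_count_def S_def)
  next
    case False
    then have "fps_nth (S n) 0 = 0"
      using n by (intro log_recurrence_constant_term[OF rec]) auto
    then show ?thesis
      using False finite_colored_factorizations[OF n]
      by (auto simp: f_count_def S_def factorization_gf_X_nth)
  qed
  with rec show ?thesis by blast
qed

lemma g_count_series:
  "\<exists>S. log_recurrence (- l) (- fps_X) S \<and> (\<forall>n k. n > 0 \<longrightarrow> g_count k l n = fps_nth (S n) k)"
proof -
  define S where "S = (\<lambda>n. if l > 0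
      then factorization_gf (fps_X :: int fps) (distinct_colored_factorizations (nat l)) n
      else fds_nth (fds_prod_ge2 (\<lambda>m. (1 - fds_monom (- fps_X) m) powi l)) n)"
  have rec: "log_recurrence (- l) (- fps_X) S"
    using log_recurrence_distinct[of "nat l" "fps_X :: int fps"]
      log_recurrence_product[of l "- fps_X :: int fps"]
    by (cases "l > 0") (simp_all add: S_def)
  have "g_count k l n = fps_nth (S n) k" if n: "n > 0" for n k
  proof (cases "n = 1")
    case True
    then show ?thesis
      using factorization_gf_1(2)[of "fps_X :: int fps"] product_nth_1[of "- fps_X :: int fps"]
      by (simp add: g_count_def S_def)
  next
    case False
    then have "fps_nth (S n) 0 = 0"
      using n by (intro log_recurrence_constant_term[OF rec]) auto
    moreover have "finite (distinct_colored_factorizations (nat l) n)"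
      using finite_colored_factorizations[OF n] by (simp add: distinct_colored_factorizations_def)
    ultimately show ?thesis
      using False by (auto simp: g_count_def S_def factorization_gf_X_nth one_plus_monom)
  qed
  with rec show ?thesis by blast
qed

section \<open>From prime multiplicities to the logarithm\<close>

text \<open>A range of primes that is the same for all \<open>m\<close> allows the sums over \<open>p\<close> and \<open>d\<close> to be swapped.\<close>

lemma ln_eq_sum_multiplicity:
  assumes "m \<ge> 1" "m \<le> n"
  shows "ln (real m) = (\<Sum>p | prime p \<and> p \<le> n. real (multiplicity p m) * ln (real p))"
proof -
  have "ln (real m) = ln (real (\<Prod>p\<in>prime_factors m. p ^ multiplicity p m))"
    using arg_cong[OF prime_factorization_nat[of m], of "\<lambda>x. ln (real x)"] assms by linarith
  also have "\<dots> = ln (\<Prod>p\<in>prime_factors m. real p ^ multiplicity p m)"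
    by simp
  also have "\<dots> = (\<Sum>p\<in>prime_factors m. real (multiplicity p m) * ln (real p))"
    by (subst ln_prod) (auto simp: ln_realpow prime_gt_0_nat in_prime_factors_iff intro!: sum.cong)
  also have "\<dots> = (\<Sum>p | prime p \<and> p \<le> n. real (multiplicity p m) * ln (real p))"
    using assms
    by (intro sum.mono_neutral_left)
       (auto simp: in_prime_factors_iff not_dvd_imp_multiplicity_0 intro: le_trans[OF dvd_imp_le])
  finally show ?thesis .
qed

lemma ln_identity_of_multiplicity_identity:
  fixes a l :: int and h :: "nat \<Rightarrow> nat \<Rightarrow> int"
  assumes n: "n > 0"
    and eq: "\<And>p. prime p \<Longrightarrow> int (multiplicity p n) * a =
      l * (\<Sum>(d, i)\<in>power_divisors n. int (multiplicity p d) * h d i)"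
  shows "real_of_int a * ln (real n) =
      real_of_int l * (\<Sum>(d, i)\<in>power_divisors n. real_of_int (h d i) * ln (real d))"
proof -
  let ?P = "{p. prime p \<and> p \<le> n}"
  have "real_of_int a * ln (real n) =
      (\<Sum>p\<in>?P. real_of_int (int (multiplicity p n) * a) * ln (real p))"
    using ln_eq_sum_multiplicity[of n n] n by (simp add: sum_distrib_left mult_ac)
  also have "\<dots> = (\<Sum>p\<in>?P. real_of_int l * (\<Sum>(d, i)\<in>power_divisors n.
      real_of_int (h d i) * (real (multiplicity p d) * ln (real p))))"
  proof (intro sum.cong refl)
    fix p assume "p \<in> ?P"
    then have "prime p" by simp
    show "real_of_int (int (multiplicity p n) * a) * ln (real p) =
        real_of_int l * (\<Sum>(d, i)\<in>power_divisors n.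
          real_of_int (h d i) * (real (multiplicity p d) * ln (real p)))"
      unfolding eq[OF \<open>prime p\<close>]
      by (simp add: case_prod_unfold sum_distrib_left sum_distrib_right mult_ac)
  qed
  also have "\<dots> = real_of_int l * (\<Sum>p\<in>?P. \<Sum>(d, i)\<in>power_divisors n.
      real_of_int (h d i) * (real (multiplicity p d) * ln (real p)))"
    by (rule sum_distrib_left[symmetric])
  also have "\<dots> = real_of_int l * (\<Sum>(d, i)\<in>power_divisors n. \<Sum>p\<in>?P.
      real_of_int (h d i) * (real (multiplicity p d) * ln (real p)))"
    unfolding case_prod_unfold by (subst sum.swap) (rule refl)
  also have "(\<Sum>(d, i)\<in>power_divisors n. \<Sum>p\<in>?P.
      real_of_int (h d i) * (real (multiplicity p d) * ln (real p))) =
      (\<Sum>(d, i)\<in>power_divisors n. real_of_int (h d i) * ln (real d))"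
  proof (intro sum.cong refl, clarify)
    fix d i assume "(d, i) \<in> power_divisors n"
    then have "1 \<le> d" "d \<le> n" by (auto simp: power_divisors_Sigma[OF n])
    then show "(\<Sum>p\<in>?P. real_of_int (h d i) * (real (multiplicity p d) * ln (real p))) =
        real_of_int (h d i) * ln (real d)"
      using ln_eq_sum_multiplicity[of d n] by (simp add: sum_distrib_left)
  qed
  finally show ?thesis .
qed

lemma log_recurrence_ln:
  fixes S :: "nat \<Rightarrow> int"
  assumes "log_recurrence e z S" and n: "n > 0"
  shows "real_of_int (S n) * ln (real n) = real_of_int e *
      (\<Sum>(d, i)\<in>power_divisors n. real_of_int (z ^ i * S (n div d ^ i)) * ln (real d))"
  using assms completely_additive_multiplicity
  by (intro ln_identity_of_multiplicity_identity) (auto simp: log_recurrence_def)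

text \<open>
  Multiplication by \<open>fps_X ^ i\<close> shifts the coefficients of a power series by \<open>i\<close>; this is where the
  restriction \<open>i \<le> k\<close> and the index \<open>k - i\<close> come from.
\<close>

lemma log_recurrence_ln_fps:
  fixes S :: "nat \<Rightarrow> int fps"
  assumes S: "log_recurrence e (of_int c * fps_X) S" and n: "n > 0"
  shows "real_of_int (fps_nth (S n) k) * ln (real n) = real_of_int e *
      (\<Sum>(d, i) | d \<ge> 2 \<and> 1 \<le> i \<and> i \<le> k \<and> d ^ i dvd n.
        real_of_int (c ^ i * fps_nth (S (n div d ^ i)) (k - i)) * ln (real d))"
proof -
  define h where "h = (\<lambda>d i. if i \<le> k then c ^ i * fps_nth (S (n div d ^ i)) (k - i) else 0)"
  have nth: "fps_nth ((of_int c * fps_X) ^ i * S (n div d ^ i)) k = h d i" for d i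
  proof -
    have "(of_int c * fps_X) ^ i * S (n div d ^ i) = of_int (c ^ i) * (fps_X ^ i * S (n div d ^ i))"
      by (simp add: power_mult_distrib mult.assoc)
    then show ?thesis
      by (simp only: h_def fps_mult_of_int_nth fps_X_power_mult_nth of_int_eq_id id_apply) simp
  qed
  have "real_of_int (fps_nth (S n) k) * ln (real n) = real_of_int e *
      (\<Sum>(d, i)\<in>power_divisors n. real_of_int (h d i) * ln (real d))"
  proof (rule ln_identity_of_multiplicity_identity[OF n])
    fix p :: nat assume p: "prime p"
    have "of_nat (multiplicity p n) * S n = of_int e * (\<Sum>(d, i)\<in>power_divisors n.
        of_nat (multiplicity p d) * ((of_int c * fps_X) ^ i * S (n div d ^ i)))"
      using S completely_additive_multiplicity[OF p] n by (auto simp: log_recurrence_def)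
    then have "fps_nth (of_nat (multiplicity p n) * S n) k = fps_nth (of_int e *
        (\<Sum>(d, i)\<in>power_divisors n.
          of_nat (multiplicity p d) * ((of_int c * fps_X) ^ i * S (n div d ^ i)))) k"
      by simp
    then show "int (multiplicity p n) * fps_nth (S n) k =
        e * (\<Sum>(d, i)\<in>power_divisors n. int (multiplicity p d) * h d i)"
      by (simp only: fps_mult_of_nat_nth fps_mult_of_int_nth fps_sum_nth case_prod_unfold nth
          of_int_eq_id id_apply)
  qed
  also have "(\<Sum>(d, i)\<in>power_divisors n. real_of_int (h d i) * ln (real d)) =
      (\<Sum>(d, i) | d \<ge> 2 \<and> 1 \<le> i \<and> i \<le> k \<and> d ^ i dvd n.
        real_of_int (c ^ i * fps_nth (S (n div d ^ i)) (k - i)) * ln (real d))"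
    by (rule sum.mono_neutral_cong_right[OF finite_power_divisors[OF n]])
       (auto simp: power_divisors_def h_def split: if_splits)
  finally show ?thesis .
qed

theorem theorem4:
  fixes n k :: nat and l :: int
  assumes "n \<ge> 2" and "k \<ge> 1" and "l \<noteq> 0"
  shows
    "(real_of_int (A_count l n) * ln (real n) =
        real_of_int l * (\<Sum>(d, i) | d \<ge> 2 \<and> i \<ge> 1 \<and> d ^ i dvd n.
          real_of_int (A_count l (n div d ^ i)) * ln (real d))) \<and>
     (real_of_int (B_count l n) * ln (real n) =
        real_of_int l * (\<Sum>(d, i) | d \<ge> 2 \<and> i \<ge> 1 \<and> d ^ i dvd n.
          (-1) ^ (i + 1) * real_of_int (B_count l (n div d ^ i)) * ln (real d))) \<and>
     (real_of_int (f_count k l n) * ln (real n) =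
        real_of_int l * (\<Sum>(d, i) | d \<ge> 2 \<and> 1 \<le> i \<and> i \<le> k \<and> d ^ i dvd n.
          real_of_int (f_count (k - i) l (n div d ^ i)) * ln (real d))) \<and>
     (real_of_int (g_count k l n) * ln (real n) =
        real_of_int l * (\<Sum>(d, i) | d \<ge> 2 \<and> 1 \<le> i \<and> i \<le> k \<and> d ^ i dvd n.
          (-1) ^ (i + 1) * real_of_int (g_count (k - i) l (n div d ^ i)) * ln (real d)))"
proof (intro conjI)
  have n: "n > 0" using assms by simp
  show "real_of_int (A_count l n) * ln (real n) =
        real_of_int l * (\<Sum>(d, i) | d \<ge> 2 \<and> i \<ge> 1 \<and> d ^ i dvd n.
          real_of_int (A_count l (n div d ^ i)) * ln (real d))"
    using log_recurrence_ln[OF log_recurrence_A_count n]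
    by (simp add: power_divisors_def)
  show "real_of_int (B_count l n) * ln (real n) =
        real_of_int l * (\<Sum>(d, i) | d \<ge> 2 \<and> i \<ge> 1 \<and> d ^ i dvd n.
          (-1) ^ (i + 1) * real_of_int (B_count l (n div d ^ i)) * ln (real d))"
    using log_recurrence_ln[OF log_recurrence_B_count n]
    by (simp add: power_divisors_def case_prod_unfold sum_negf)
  obtain F where F: "log_recurrence l fps_X F"
      "\<And>m j. m > 0 \<Longrightarrow> f_count j l m = fps_nth (F m) j"
    using f_count_series[of l] by blast
  have "real_of_int (f_count k l n) * ln (real n) =
      real_of_int l * (\<Sum>(d, i) | d \<ge> 2 \<and> 1 \<le> i \<and> i \<le> k \<and> d ^ i dvd n.
        real_of_int (fps_nth (F (n div d ^ i)) (k - i)) * ln (real d))"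
    using log_recurrence_ln_fps[of l 1 F n k] F n by simp
  also have "\<dots> = real_of_int l * (\<Sum>(d, i) | d \<ge> 2 \<and> 1 \<le> i \<and> i \<le> k \<and> d ^ i dvd n.
        real_of_int (f_count (k - i) l (n div d ^ i)) * ln (real d))"
    using F(2) div_power_pos[OF n] by (intro arg_cong2[of _ _ _ _ "(*)"] sum.cong) auto
  finally show "real_of_int (f_count k l n) * ln (real n) =
      real_of_int l * (\<Sum>(d, i) | d \<ge> 2 \<and> 1 \<le> i \<and> i \<le> k \<and> d ^ i dvd n.
        real_of_int (f_count (k - i) l (n div d ^ i)) * ln (real d))" .
  obtain G where G: "log_recurrence (- l) (- fps_X) G"
      "\<And>m j. m > 0 \<Longrightarrow> g_count j l m = fps_nth (G m) j"
    using g_count_series[of l] by blast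
  have "real_of_int (g_count k l n) * ln (real n) =
      real_of_int l * (\<Sum>(d, i) | d \<ge> 2 \<and> 1 \<le> i \<and> i \<le> k \<and> d ^ i dvd n.
        (-1) ^ (i + 1) * real_of_int (fps_nth (G (n div d ^ i)) (k - i)) * ln (real d))"
    using log_recurrence_ln_fps[of "- l" "- 1" G n k] G n
    by (simp add: case_prod_unfold sum_negf)
  also have "\<dots> = real_of_int l * (\<Sum>(d, i) | d \<ge> 2 \<and> 1 \<le> i \<and> i \<le> k \<and> d ^ i dvd n.
        (-1) ^ (i + 1) * real_of_int (g_count (k - i) l (n div d ^ i)) * ln (real d))"
    using G(2) div_power_pos[OF n] by (intro arg_cong2[of _ _ _ _ "(*)"] sum.cong) auto
  finally show "real_of_int (g_count k l n) * ln (real n) =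
      real_of_int l * (\<Sum>(d, i) | d \<ge> 2 \<and> 1 \<le> i \<and> i \<le> k \<and> d ^ i dvd n.
        (-1) ^ (i + 1) * real_of_int (g_count (k - i) l (n div d ^ i)) * ln (real d))" .
qed

end
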